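(* Let $q$ be a prime power, $\mathbb{F}=\mathbb{F}_q$, $n\ge1$ and $a,b\in\mathbb{F}$. Then \[ |\mathcal{C}^{*}_{a,b}|=\Big|\bigcup_{i\in[n]}\mathcal{C}^i_{a,b}\Big|=\sum_{k=1}^{n}(-1)^{k-1}C(n,k)\,q^{(q-1)^{k}q^{n-k}}. \]
   Context: $[n]=\{1,\dots,n\}$ and $C(n,k)=\frac{n!}{k!(n-k)!}$. For $i\in[n]$ and $a,b\in\mathbb{F}$, $\mathcal{C}^i_{a,b}$ denotes the set of all functions $f:\mathbb{F}^n\to\mathbb{F}$ such that $f(x_1,\dots,x_{i-1},a,x_{i+1},\dots,x_n)=b$ for all $(x_1,\dots,x_n)\in\mathbb{F}^n$ (functions canalyzing in the $i$th variable with canalyzing input $a$ and canalyzed output $b$). $\mathcal{C}^*_{a,b}=\bigcup_{i\in[n]}\mathcal{C}^i_{a,b}$. *)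

theory Defs
  imports "HOL-Library.FuncSet" "HOL-Library.Cardinality" "HOL-Number_Theory.Prime_Powers"
begin

text \<open>
  A vector \<open>(x\<^sub>1, \<dots>, x\<^sub>n)\<close> is an extensional function on \<open>{1..n}\<close>, and a function on vectors
  is extensional on the set of all vectors, so that each mathematical function is represented by
  exactly one HOL function and cardinalities are the intended ones.
\<close>

definition vecs :: "nat \<Rightarrow> (nat \<Rightarrow> 'a) set" where
  "vecs n = {1..n} \<rightarrow>\<^sub>E UNIV"

definition funs :: "nat \<Rightarrow> ((nat \<Rightarrow> 'a) \<Rightarrow> 'a) set" where
  "funs n = vecs n \<rightarrow>\<^sub>E UNIV"

definition canalyzing :: "nat \<Rightarrow> nat \<Rightarrow> 'a \<Rightarrow> 'a \<Rightarrow> ((nat \<Rightarrow> 'a) \<Rightarrow> 'a) set" where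
  "canalyzing n i a b = {f \<in> funs n. \<forall>x \<in> vecs n. f (x(i := a)) = b}"

definition canalyzing_some :: "nat \<Rightarrow> 'a \<Rightarrow> 'a \<Rightarrow> ((nat \<Rightarrow> 'a) \<Rightarrow> 'a) set" where
  "canalyzing_some n a b = (\<Union>i\<in>{1..n}. canalyzing n i a b)"

end

theory Submission
  imports Defs
begin

text \<open>
  Being canalyzing in every variable of \<open>I\<close> means taking the value \<open>b\<close> on all vectors having some
  coordinate in \<open>I\<close> equal to \<open>a\<close>, with no condition on the \<open>(q - 1)\<^bsup>|I|\<^esup> q\<^bsup>n - |I|\<^esup>\<close> vectors whose
  \<open>I\<close>-coordinates all avoid \<open>a\<close>. Inclusion-exclusion over the sets \<open>I\<close> then gives the count.
\<close>

lemma finite_vecs [simp]: "finite (vecs n :: (nat \<Rightarrow> 'a :: finite) set)"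
  by (simp add: vecs_def finite_PiE)

lemma finite_funs [simp]: "finite (funs n :: ((nat \<Rightarrow> 'a :: finite) \<Rightarrow> 'a) set)"
  by (simp add: funs_def finite_PiE)

text \<open>The coordinates are chosen independently: each index in \<open>I\<close> excludes the
  single value \<open>a\<close>, every other index is unrestricted, so the set is a product.\<close>

lemma card_vecs_avoiding:
  fixes a :: "'a :: finite"
  assumes "I \<subseteq> {1..n}"
  shows "card {x \<in> vecs n. \<forall>i\<in>I. x i \<noteq> a} = (CARD('a) - 1) ^ card I * CARD('a) ^ (n - card I)"
proof -
  have "{x \<in> vecs n. \<forall>i\<in>I. x i \<noteq> a} = (\<Pi>\<^sub>E i\<in>{1..n}. if i \<in> I then UNIV - {a} else UNIV)"
    using assms unfolding set_eq_iff vecs_def mem_Collect_eq PiE_iff by auto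
  then have "card {x \<in> vecs n. \<forall>i\<in>I. x i \<noteq> a}
      = (\<Prod>i\<in>{1..n}. if i \<in> I then CARD('a) - 1 else CARD('a))"
    by (simp add: card_PiE if_distrib cong: if_cong)
  also have "\<dots> = (CARD('a) - 1) ^ card ({1..n} \<inter> I) * CARD('a) ^ card ({1..n} - I)"
    by (simp add: prod.If_cases Diff_eq)
  also have "{1..n} \<inter> I = I"
    using assms by blast
  also have "card ({1..n} - I) = n - card I"
    using assms by (simp add: card_Diff_subset finite_subset)
  finally show ?thesis .
qed

text \<open>Since \<open>i\<close> is a valid index, \<open>x(i := a)\<close> is again a vector, and
  a vector with \<open>x i = a\<close> is its own update. In this form the conditions for several
  \<open>i\<close> combine into one set of vectors where the value is forced.\<close>

lemma canalyzing_iff: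
  assumes "i \<in> {1..n}"
  shows "f \<in> canalyzing n i a b \<longleftrightarrow> f \<in> funs n \<and> (\<forall>x\<in>vecs n. x i = a \<longrightarrow> f x = b)"
proof -
  have "x(i := a) \<in> vecs n" if "x \<in> vecs n" for x :: "nat \<Rightarrow> 'a"
    using that assms by (auto simp: vecs_def PiE_iff extensional_def)
  then show ?thesis
    unfolding canalyzing_def mem_Collect_eq by (metis fun_upd_same fun_upd_triv)
qed

text \<open>Nonemptiness of \<open>I\<close> keeps the intersection inside \<open>funs n\<close>;
  over the empty family it would be the whole type.\<close>

lemma card_Inter_canalyzing:
  fixes a b :: "'a :: finite"
  assumes "I \<subseteq> {1..n}" "I \<noteq> {}"
  shows "card (\<Inter>i\<in>I. canalyzing n i a b)
    = CARD('a) ^ ((CARD('a) - 1) ^ card I * CARD('a) ^ (n - card I))"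
proof -
  let ?free = "{x \<in> vecs n. \<forall>i\<in>I. x i \<noteq> a}"
  have "f \<in> (\<Inter>i\<in>I. canalyzing n i a b)
      \<longleftrightarrow> f \<in> funs n \<and> (\<forall>x\<in>vecs n. (\<exists>i\<in>I. x i = a) \<longrightarrow> f x = b)" for f
  proof -
    have "f \<in> (\<Inter>i\<in>I. canalyzing n i a b)
        \<longleftrightarrow> (\<forall>i\<in>I. f \<in> funs n \<and> (\<forall>x\<in>vecs n. x i = a \<longrightarrow> f x = b))"
      using assms canalyzing_iff[of _ n f a b] by blast
    then show ?thesis
      using assms by blast
  qed
  \<comment> \<open>The values of \<open>f\<close> are independent: arbitrary on
    \<open>?free\<close>, confined to \<open>{b}\<close> elsewhere. Each forced vector thus
    contributes a factor 1.\<close>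
  then have "(\<Inter>i\<in>I. canalyzing n i a b)
      = (\<Pi>\<^sub>E x\<in>vecs n. if x \<in> ?free then UNIV else {b})"
    unfolding set_eq_iff funs_def PiE_iff by simp blast
  then have "card (\<Inter>i\<in>I. canalyzing n i a b)
      = (\<Prod>x\<in>vecs n. if x \<in> ?free then CARD('a) else 1)"
    by (simp add: card_PiE if_distrib cong: if_cong)
  also have "\<dots> = CARD('a) ^ card (vecs n \<inter> ?free)"
    by (subst prod.If_cases) simp_all
  also have "vecs n \<inter> ?free = ?free"
    by blast
  finally show ?thesis
    using assms by (simp add: card_vecs_avoiding)
qed

theorem theorem3p9:
  fixes q n :: nat and a b :: "'a :: {field, finite}"
  assumes "primepow q" and "CARD('a) = q" and "n \<ge> 1"
  shows "card (canalyzing_some n a b) = card (\<Union>i\<in>{1..n}. canalyzing n i a b)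
    \<and> int (card (\<Union>i\<in>{1..n}. canalyzing n i a b)) =
      (\<Sum>k=1..n. (-1) ^ (k - 1) * int (n choose k) * int q ^ ((q - 1) ^ k * q ^ (n - k)))"
proof
  show "card (canalyzing_some n a b) = card (\<Union>i\<in>{1..n}. canalyzing n i a b)"
    by (simp add: canalyzing_some_def)
next
  let ?g = "\<lambda>k. (-1) ^ (k + 1) * int q ^ ((q - 1) ^ k * q ^ (n - k))"
  let ?S = "{I. I \<subseteq> {1..n} \<and> I \<noteq> {}}"
  have fin: "finite (canalyzing n i a b)" for i
    unfolding canalyzing_def by simp
  have "int (card (\<Union>i\<in>{1..n}. canalyzing n i a b))
      = (\<Sum>I\<in>?S. (-1) ^ (card I + 1) * int (card (\<Inter>i\<in>I. canalyzing n i a b)))"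
  proof -
    \<comment> \<open>Cardinalities are taken in the integers because the sum alternates in sign;
      additivity on disjoint finite sets is what inclusion-exclusion requires.\<close>
    interpret Incl_Excl finite "int \<circ> card"
      by unfold_locales (auto simp: card_Un_disjnt)
    show ?thesis
      using restricted_indexed[of "{1..n}" "\<lambda>i. canalyzing n i a b"] fin by simp
  qed
  also have "\<dots> = (\<Sum>I\<in>?S. ?g (card I))"
    by (intro sum.cong) (simp_all add: card_Inter_canalyzing assms(2))
  \<comment> \<open>The summand depends on \<open>I\<close> only through its size, so the index sets
    are grouped by size.\<close>
  also have "\<dots> = (\<Sum>k=1..n. \<Sum>I | I \<in> ?S \<and> card I = k. ?g (card I))"
  proof (rule sum.group[symmetric])
    show "card ` ?S \<subseteq> {1..n}"
    proof (rule image_subsetI)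
      fix I assume "I \<in> ?S"
      then have I: "I \<subseteq> {1..n}" "I \<noteq> {}"
        by simp_all
      then have "finite I"
        using finite_subset by blast
      then show "card I \<in> {1..n}"
        using I card_mono[OF _ I(1)] by (simp add: Suc_le_eq card_gt_0_iff)
    qed
  qed simp_all
  also have "\<dots> = (\<Sum>k=1..n. (-1) ^ (k - 1) * int (n choose k) * int q ^ ((q - 1) ^ k * q ^ (n - k)))"
  proof (rule sum.cong[OF refl])
    fix k assume k: "k \<in> {1..n}"
    \<comment> \<open>As \<open>k\<close> is positive, a set of size \<open>k\<close> is
      automatically nonempty.\<close>
    then have "{I. I \<in> ?S \<and> card I = k} = {I. I \<subseteq> {1..n} \<and> card I = k}"
      by auto
    then have "card {I. I \<in> ?S \<and> card I = k} = n choose k"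
      by (simp add: n_subsets)
    \<comment> \<open>The exponents differ by 2, because \<open>k\<close> is positive and the
      subtraction on naturals does not truncate.\<close>
    moreover have "(-1 :: int) ^ (k + 1) = (-1) ^ (k - 1)"
      using k by (cases k) simp_all
    ultimately show "(\<Sum>I | I \<in> ?S \<and> card I = k. ?g (card I))
        = (-1) ^ (k - 1) * int (n choose k) * int q ^ ((q - 1) ^ k * q ^ (n - k))"
      by simp
  qed
  finally show "int (card (\<Union>i\<in>{1..n}. canalyzing n i a b)) =
      (\<Sum>k=1..n. (-1) ^ (k - 1) * int (n choose k) * int q ^ ((q - 1) ^ k * q ^ (n - k)))" .
qed

end
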